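(* Let $s$ be a step sequence over a g-comtrace alphabet $(E,sim,ser,inl)$. Then $G^{\{s\}}$ is a gso-structure.
   Context: Relations: for $R$ on $X$, $R^{-1}$ inverse, $R^*=\bigcup_{i\ge0}R^i$ ($R^0=\mathrm{id}_X$), $R\circ S=\{(x,y):\exists z.\,xRz\wedge zSy\}$, $R^{\mathrm{sym}}=R\cup R^{-1}$, $R^{\Cap}=R\cap R^{-1}$, $R^C=(X\times X)\setminus R$. A g-comtrace alphabet is $(E,sim,ser,inl)$ with $E$ finite, $sim,inl\subseteq E\times E$ irreflexive and symmetric, $ser\subseteq sim$, $sim\cap inl=\emptyset$. Steps $\mathbb{S}$: nonempty $A\subseteq E$ with $(a,b)\in sim$ for all distinct $a,b\in A$; step sequences: elements of $\mathbb{S}^*$. $\equiv$ is the reflexive symmetric transitive closure of the pairs $(wAz,wBCz)$ ($A,B,C\in\mathbb{S}$, $A=B\cup C$, $B\times C\subseteq ser$) and $(wABz,wBAz)$ ($A,B\in\mathbb{S}$, $A\times B\subseteq inl$). For $s=A_1\dots A_k$: $\overline{A_i}=\{e^{(m+1)}:e\in A_i\}$ where $m$ is the number of $j<i$ with $e\in A_j$; $\Sigma_s=\bigcup_i\overline{A_i}$; $l(e^{(j)})=e$; $pos_s(\alpha)=i$ iff $\alpha\in\overline{A_i}$; $\alpha\lhd_s\beta$ iff $pos_s(\alpha)<pos_s(\beta)$; $\alpha\lhd_s^\frown\beta$ iff $\alpha\ne\beta\wedge pos_s(\alpha)\le pos_s(\beta)$. Closures: $(X,R_1,R_2)^\lozenge=(X,\prec_{R_1,R_2},\sqsubset_{R_1,R_2})$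 with $\prec_{R_1,R_2}=(R_1\cup R_2)^*\circ R_1\circ(R_1\cup R_2)^*$, $\sqsubset_{R_1,R_2}=(R_1\cup R_2)^*\setminus\mathrm{id}_X$; for $R_3=R_1\cap R_2^*$, $(X,R_1,R_2)^{\bowtie}=(X,(\prec_{R_3,R_2})^{\mathrm{sym}}\cup R_1,\sqsubset_{R_3,R_2})$. On $\Sigma_s$: $\alpha<\!\!>_s\beta$ iff $(l(\alpha),l(\beta))\in inl$; $\alpha\sqsubset_s\beta$ iff $\alpha\lhd_s^\frown\beta$ and $(l(\beta),l(\alpha))\notin ser\cup inl$; $\alpha\prec_s\beta$ iff $\alpha\lhd_s\beta$ and one of: (i) $(l(\alpha),l(\beta))\notin ser\cup inl$; (ii) $(\alpha,\beta)\in<\!\!>_s\cap((\sqsubset_s^* )^{\Cap}\circ(<\!\!>_s)^C\circ(\sqsubset_s^* )^{\Cap})$; (iii) $(l(\alpha),l(\beta))\in ser$ and there are $\delta,\gamma\in\Sigma_s$ with $\delta\lhd_s\gamma$, $(l(\delta),l(\gamma))\notin ser$, $\alpha\sqsubset_s^*\delta\sqsubset_s^*\beta$, $\alpha\sqsubset_s^*\gamma\sqsubset_s^*\beta$. $G^{\{s\}}=(\Sigma_s,\prec_s\cup<\!\!>_s,\prec_s\cup\sqsubset_s)^{\bowtie}$. An so-structure is $(X,\prec,\sqsubset)$ such that for all $a,b,c\in X$: $\neg(a\sqsubset a)$; $a\prec b\Rightarrow a\sqsubset b$; $a\sqsubset b\sqsubset c\wedge a\ne c\Rightarrow a\sqsubset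 c$; $(a\sqsubset b\prec c\vee a\prec b\sqsubset c)\Rightarrow a\prec c$. A gso-structure is $(X,<\!\!>,\sqsubset)$ with $\sqsubset$ irreflexive, $<\!\!>$ symmetric and irreflexive, and $(X,<\!\!>\cap\sqsubset,\sqsubset)$ an so-structure. *)

theory Defs
  imports Main
begin

section \<open>Relations on a carrier\<close>

text \<open>Reflexive transitive closure with \<open>R\<^sup>0\<close> the identity on the carrier \<open>X\<close>; the library's
  \<open>R\<^sup>*\<close> would contain the identity on the whole type.\<close>

definition star_on :: "'a set \<Rightarrow> 'a rel \<Rightarrow> 'a rel"
  where "star_on X R = Id_on X \<union> R\<^sup>+"

lemma star_on_eq_UN_relpow: "star_on X R = (\<Union>i. if i = 0 then Id_on X else R ^^ i)"
proof -
  have "R\<^sup>+ = (\<Union>i\<in>{0<..}. R ^^ i)"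
    by (auto simp: trancl_power simp del: relpow.simps)
  moreover have "(\<Union>i. if i = 0 then Id_on X else R ^^ i) = Id_on X \<union> (\<Union>i\<in>{0<..}. R ^^ i)"
    by (auto simp del: relpow.simps split: if_splits)
  ultimately show ?thesis
    by (simp add: star_on_def)
qed

definition sym_cl :: "'a rel \<Rightarrow> 'a rel"
  where "sym_cl R = R \<union> R\<inverse>"

definition sym_core :: "'a rel \<Rightarrow> 'a rel"
  where "sym_core R = R \<inter> R\<inverse>"

definition compl_on :: "'a set \<Rightarrow> 'a rel \<Rightarrow> 'a rel"
  where "compl_on X R = X \<times> X - R"


section \<open>Relational structures and their closure\<close>

type_synonym 'a rel_struct = "'a set \<times> 'a rel \<times> 'a rel"

fun so_structure :: "'a rel_struct \<Rightarrow> bool" where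
  "so_structure (X, P, Q) \<longleftrightarrow>
     P \<subseteq> X \<times> X \<and> Q \<subseteq> X \<times> X \<and>
     (\<forall>a\<in>X. \<forall>b\<in>X. \<forall>c\<in>X.
        (a, a) \<notin> Q \<and>
        ((a, b) \<in> P \<longrightarrow> (a, b) \<in> Q) \<and>
        ((a, b) \<in> Q \<and> (b, c) \<in> Q \<and> a \<noteq> c \<longrightarrow> (a, c) \<in> Q) \<and>
        (((a, b) \<in> Q \<and> (b, c) \<in> P) \<or> ((a, b) \<in> P \<and> (b, c) \<in> Q) \<longrightarrow> (a, c) \<in> P))"

fun gso_structure :: "'a rel_struct \<Rightarrow> bool" where
  "gso_structure (X, C, Q) \<longleftrightarrow>
     C \<subseteq> X \<times> X \<and> Q \<subseteq> X \<times> X \<and>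
     irrefl Q \<and> sym C \<and> irrefl C \<and> so_structure (X, C \<inter> Q, Q)"

text \<open>The two relations of the closure \<open>(X, R1, R2)\<^sup>\<diamond>\<close>.\<close>

definition prec_cl :: "'a set \<Rightarrow> 'a rel \<Rightarrow> 'a rel \<Rightarrow> 'a rel"
  where "prec_cl X R1 R2 = star_on X (R1 \<union> R2) O R1 O star_on X (R1 \<union> R2)"

definition sqsub_cl :: "'a set \<Rightarrow> 'a rel \<Rightarrow> 'a rel \<Rightarrow> 'a rel"
  where "sqsub_cl X R1 R2 = star_on X (R1 \<union> R2) - Id_on X"

text \<open>The closure \<open>(X, R1, R2)\<^sup>\<bowtie>\<close>.\<close>

fun bowtie :: "'a rel_struct \<Rightarrow> 'a rel_struct" where
  "bowtie (X, R1, R2) =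
     (let R3 = R1 \<inter> star_on X R2
      in (X, sym_cl (prec_cl X R3 R2) \<union> R1, sqsub_cl X R3 R2))"


section \<open>Generalized comtrace alphabets and step sequences\<close>

locale g_comtrace_alphabet =
  fixes E :: "'e set" and sim ser inl :: "'e rel"
  assumes finite_E: "finite E"
    and sim_sub: "sim \<subseteq> E \<times> E" and irrefl_sim: "irrefl sim" and sym_sim: "sym sim"
    and inl_sub: "inl \<subseteq> E \<times> E" and irrefl_inl: "irrefl inl" and sym_inl: "sym inl"
    and ser_sub: "ser \<subseteq> sim"
    and sim_inl_disjoint: "sim \<inter> inl = {}"

definition steps :: "'e set \<Rightarrow> 'e rel \<Rightarrow> 'e set set"
  where "steps E sim =
    {A. A \<noteq> {} \<and> A \<subseteq> E \<and> (\<forall>a\<in>A. \<forall>b\<in>A. a \<noteq> b \<longrightarrow> (a, b) \<in> sim)}"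

definition step_sequences :: "'e set \<Rightarrow> 'e rel \<Rightarrow> 'e set list set"
  where "step_sequences E sim = lists (steps E sim)"


section \<open>Event occurrences\<close>

text \<open>The occurrence \<open>e\<^sup>(\<^sup>j\<^sup>)\<close> is the pair \<open>(e, j)\<close>, with \<open>j\<close> counted from 1.\<close>

type_synonym 'e occ = "'e \<times> nat"

abbreviation label :: "'e occ \<Rightarrow> 'e"
  where "label \<equiv> fst"

text \<open>Steps are indexed from 0, as list positions are. Positions are only ever compared, so the
  shift against a numbering from 1 is immaterial.\<close>

definition enum_step :: "'e set list \<Rightarrow> nat \<Rightarrow> 'e occ set"
  where "enum_step s i = {(e, card {j. j < i \<and> e \<in> s ! j} + 1) | e. e \<in> s ! i}"

definition occs :: "'e set list \<Rightarrow> 'e occ set"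
  where "occs s = (\<Union>i<length s. enum_step s i)"

definition pos :: "'e set list \<Rightarrow> 'e occ \<Rightarrow> nat"
  where "pos s \<alpha> = (THE i. i < length s \<and> \<alpha> \<in> enum_step s i)"

lemma enum_step_less_disjoint:
  assumes "i < k" "\<alpha> \<in> enum_step s i"
  shows "\<alpha> \<notin> enum_step s k"
proof
  assume "\<alpha> \<in> enum_step s k"
  then obtain e where e: "e \<in> s ! i"
    and eq: "card {j. j < i \<and> e \<in> s ! j} = card {j. j < k \<and> e \<in> s ! j}"
    using assms(2) by (auto simp: enum_step_def)
  have "card {j. j < i \<and> e \<in> s ! j} < card {j. j < k \<and> e \<in> s ! j}"
    using assms(1) e by (intro psubset_card_mono) auto
  with eq show False by simp
qed

lemma pos_iff:
  assumes "\<alpha> \<in> occs s"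
  shows "pos s \<alpha> = i \<longleftrightarrow> i < length s \<and> \<alpha> \<in> enum_step s i"
proof -
  obtain k where k: "k < length s" "\<alpha> \<in> enum_step s k"
    using assms by (auto simp: occs_def)
  moreover have "j = k" if "\<alpha> \<in> enum_step s j" for j
    using that k(2) by (metis enum_step_less_disjoint linorder_neqE_nat)
  ultimately show ?thesis
    unfolding pos_def by (metis (mono_tags, lifting) the_equality)
qed

definition before :: "'e set list \<Rightarrow> 'e occ rel"
  where "before s = {(\<alpha>, \<beta>) \<in> occs s \<times> occs s. pos s \<alpha> < pos s \<beta>}"

definition not_after :: "'e set list \<Rightarrow> 'e occ rel"
  where "not_after s = {(\<alpha>, \<beta>) \<in> occs s \<times> occs s. \<alpha> \<noteq> \<beta> \<and> pos s \<alpha> \<le> pos s \<beta>}"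


section \<open>The structure of a step sequence\<close>

text \<open>\<open>comm_rel\<close>, \<open>sqsub_rel\<close> and \<open>prec_rel\<close> are written \<open><>\<^sub>s\<close>, \<open>\<sqsubset>\<^sub>s\<close> and \<open>\<prec>\<^sub>s\<close>.\<close>

definition comm_rel :: "'e rel \<Rightarrow> 'e set list \<Rightarrow> 'e occ rel"
  where "comm_rel inl s = {(\<alpha>, \<beta>) \<in> occs s \<times> occs s. (label \<alpha>, label \<beta>) \<in> inl}"

definition sqsub_rel :: "'e rel \<Rightarrow> 'e rel \<Rightarrow> 'e set list \<Rightarrow> 'e occ rel"
  where "sqsub_rel ser inl s =
    {(\<alpha>, \<beta>) \<in> not_after s. (label \<beta>, label \<alpha>) \<notin> ser \<union> inl}"

definition prec_rel :: "'e rel \<Rightarrow> 'e rel \<Rightarrow> 'e set list \<Rightarrow> 'e occ rel"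
  where "prec_rel ser inl s =
    (let W = star_on (occs s) (sqsub_rel ser inl s); C = comm_rel inl s in
     {(\<alpha>, \<beta>) \<in> before s.
        (label \<alpha>, label \<beta>) \<notin> ser \<union> inl
        \<or> (\<alpha>, \<beta>) \<in> C \<inter> (sym_core W O compl_on (occs s) C O sym_core W)
        \<or> ((label \<alpha>, label \<beta>) \<in> ser \<and>
           (\<exists>\<delta>\<in>occs s. \<exists>\<gamma>\<in>occs s.
              (\<delta>, \<gamma>) \<in> before s \<and> (label \<delta>, label \<gamma>) \<notin> ser \<and>
              (\<alpha>, \<delta>) \<in> W \<and> (\<delta>, \<beta>) \<in> W \<and> (\<alpha>, \<gamma>) \<in> W \<and> (\<gamma>, \<beta>) \<in> W))})"

definition step_seq_struct :: "'e rel \<Rightarrow> 'e rel \<Rightarrow> 'e set list \<Rightarrow> 'e occ rel_struct"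
  where "step_seq_struct ser inl s =
    bowtie (occs s,
            prec_rel ser inl s \<union> comm_rel inl s,
            prec_rel ser inl s \<union> sqsub_rel ser inl s)"

end

(* The position of an event weakly increases along the second relation of the structure and
   differs for any two events related by the first one: events of the same step have
   labels in sim, which is disjoint from inl. Hence every pair in R3, and then every pair in
   prec_cl, strictly increases the position, so prec_cl is irreflexive and is exactly
   the intersection of the two relations of the closure. *)
theory Submission
  imports Defs
begin

lemma star_on_trans:
  assumes "(x, y) \<in> star_on X R" "(y, z) \<in> star_on X R"
  shows "(x, z) \<in> star_on X R"
  using assms unfolding star_on_def by (auto dest: trancl_trans)

lemma star_on_subset:
  assumes "R \<subseteq> X \<times> X"
  shows "star_on X R \<subseteq> X \<times> X"
  using trancl_subset_Sigma[OF assms] by (auto simp: star_on_def)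

text \<open>A pair of \<open>S\<close> is either an identity pair or an \<open>R\<close>-path, so a
  path over \<open>S \<union> R\<close> can be rewritten step by step over \<open>R\<close>. In
  \<open>bowtie\<close>, where \<open>R3\<close> lies in \<open>star_on X R2\<close>, this collapses
  the closure of \<open>R3 \<union> R2\<close> to that of \<open>R2\<close>.\<close>

lemma star_on_absorb:
  assumes "S \<subseteq> star_on X R"
  shows "star_on X (S \<union> R) = star_on X R"
proof
  have "(x, y) \<in> star_on X R" if "(x, y) \<in> (S \<union> R)\<^sup>+" for x y
    using that
  proof induction
    case (base y)
    then show ?case using assms by (auto simp: star_on_def)
  next
    case (step y z)
    then have "(y, z) \<in> star_on X R" using assms by (auto simp: star_on_def)
    with step.IH show ?case by (rule star_on_trans)
  qed
  then show "star_on X (S \<union> R) \<subseteq> star_on X R"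
    by (auto simp: star_on_def)
  have "R\<^sup>+ \<subseteq> (S \<union> R)\<^sup>+"
    by (meson subrelI trancl_mono Un_upper2)
  then show "star_on X R \<subseteq> star_on X (S \<union> R)"
    by (auto simp: star_on_def)
qed

lemma star_on_rank_mono:
  fixes f :: "'a \<Rightarrow> 'b::preorder"
  assumes "\<And>x y. (x, y) \<in> R \<Longrightarrow> f x \<le> f y"
    and "(x, y) \<in> star_on X R"
  shows "f x \<le> f y"
proof -
  have "f x \<le> f y" if "(x, y) \<in> R\<^sup>+"
    using that by induction (auto intro: assms(1) order_trans)
  with assms(2) show ?thesis by (auto simp: star_on_def)
qed

text \<open>Isolates what the argument takes from a step sequence: a rank \<open>f\<close> that
  weakly increases along the second relation and separates pairs of the first. The set
  \<open>P\<close> is shared by both relations, as \<open>prec_rel\<close> is.\<close>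

lemma gso_structure_bowtie:
  fixes f :: "'a \<Rightarrow> 'b::order"
  assumes sub: "P \<subseteq> X \<times> X" "C \<subseteq> X \<times> X" "Q \<subseteq> X \<times> X"
    and "sym C"
    and mono: "\<And>x y. (x, y) \<in> P \<union> Q \<Longrightarrow> f x \<le> f y"
    and sep: "\<And>x y. (x, y) \<in> P \<union> C \<Longrightarrow> f x \<noteq> f y"
  shows "gso_structure (bowtie (X, P \<union> C, P \<union> Q))"
proof -
  \<comment> \<open>In the notation of \<open>bowtie\<close>, \<open>W\<close> is the closure of
    \<open>R2\<close>, \<open>R\<close> is \<open>R3\<close>, and \<open>L\<close> turns out to be
    \<open>prec_cl X R3 R2\<close> once \<open>R\<close> is absorbed into \<open>W\<close>.\<close>
  define W where "W = star_on X (P \<union> Q)"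
  define R where "R = (P \<union> C) \<inter> W"
  define L where "L = W O R O W"
  have absorb: "star_on X (R \<union> (P \<union> Q)) = W"
    unfolding W_def R_def by (rule star_on_absorb) auto
  have L_eq: "prec_cl X R (P \<union> Q) = L"
    by (simp add: prec_cl_def absorb L_def)
  have W_trans: "(x, z) \<in> W" if "(x, y) \<in> W" "(y, z) \<in> W" for x y z
    using that star_on_trans unfolding W_def by fast
  have W_sub: "W \<subseteq> X \<times> X"
    unfolding W_def using sub by (intro star_on_subset) auto
  have W_refl: "(x, x) \<in> W" if "x \<in> X" for x
    using that by (auto simp: W_def star_on_def)
  have W_mono: "f x \<le> f y" if "(x, y) \<in> W" for x y
    using star_on_rank_mono[of "P \<union> Q" f] mono that unfolding W_def by blast
  have R_less: "f x < f y" if "(x, y) \<in> R" for x y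
    using that W_mono sep unfolding R_def by (simp add: order_less_le)
  have L_less: "f x < f y" if xy: "(x, y) \<in> L" for x y
  proof -
    obtain u v where "(x, u) \<in> W" "(u, v) \<in> R" "(v, y) \<in> W"
      using xy unfolding L_def by blast
    then show ?thesis
      using W_mono R_less by (meson le_less_trans less_le_trans)
  qed
  have L_W: "L \<subseteq> W"
    unfolding L_def R_def using W_trans by blast
  have L_left: "(x, z) \<in> L" if "(x, y) \<in> W" "(y, z) \<in> L" for x y z
    using that W_trans unfolding L_def by blast
  have L_right: "(x, z) \<in> L" if "(x, y) \<in> L" "(y, z) \<in> W" for x y z
    using that W_trans unfolding L_def by blast
  \<comment> \<open>Pad a pair of \<open>R\<close> with identity pairs of \<open>W\<close> at both
    ends; its endpoints lie in \<open>X\<close>.\<close>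
  have R_L: "R \<subseteq> L"
    unfolding L_def R_def using W_refl W_sub by blast
  \<comment> \<open>\<open>P\<close> occurs in both input relations, hence lies in \<open>R\<close>.
    The symmetric closure of \<open>L\<close> therefore swallows \<open>P\<close>, which leaves only
    the symmetric \<open>C\<close> beside it in \<open>D\<close>.\<close>
  have "P \<subseteq> L"
    using R_L by (auto simp: R_def W_def star_on_def)
  define D where "D = sym_cl L \<union> (P \<union> C)"
  have D: "D = sym_cl L \<union> C"
    using \<open>P \<subseteq> L\<close> by (auto simp: D_def sym_cl_def)
  have "sym D"
    using \<open>sym C\<close> unfolding D by (auto simp: sym_cl_def sym_def)
  have "irrefl D"
    using L_less sep unfolding D by (auto simp: sym_cl_def irrefl_def)
  have "D \<subseteq> X \<times> X"
    using L_W W_sub sub unfolding D sym_cl_def by blast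
  have DL: "D \<inter> (W - Id_on X) = L"
  proof (intro equalityI subrelI)
    fix x y assume "(x, y) \<in> D \<inter> (W - Id_on X)"
    \<comment> \<open>A pair of \<open>C\<close> that is also in \<open>W\<close> belongs to
      \<open>R\<close>, hence to \<open>L\<close>. A reversed pair of \<open>L\<close> would force
      \<open>f y < f x\<close>, against monotonicity along \<open>W\<close>.\<close>
    then have W: "(x, y) \<in> W" and "(x, y) \<in> L \<or> (y, x) \<in> L \<or> (x, y) \<in> R"
      by (auto simp: D sym_cl_def R_def)
    moreover have "(y, x) \<notin> L"
      using L_less W_mono[OF W] by (meson less_le_not_le)
    ultimately show "(x, y) \<in> L"
      using R_L by blast
  next
    fix x y assume "(x, y) \<in> L"
    then show "(x, y) \<in> D \<inter> (W - Id_on X)"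
      using L_W L_less by (auto simp: D sym_cl_def)
  qed
  \<comment> \<open>By \<open>DL\<close> this is the so-structure that the gso-structure requires.
    Its mixed laws hold because \<open>L\<close> absorbs \<open>W\<close> on either side.\<close>
  have "so_structure (X, L, W - Id_on X)"
    unfolding so_structure.simps
  proof (intro conjI ballI impI)
    show "L \<subseteq> X \<times> X" "W - Id_on X \<subseteq> X \<times> X"
      using L_W W_sub by auto
  next
    fix a b c assume X: "a \<in> X" "b \<in> X" "c \<in> X"
    show "(a, a) \<notin> W - Id_on X"
      using X by auto
    show "(a, b) \<in> W - Id_on X" if "(a, b) \<in> L"
      using that DL by blast
    show "(a, c) \<in> W - Id_on X"
      if "(a, b) \<in> W - Id_on X \<and> (b, c) \<in> W - Id_on X \<and> a \<noteq> c"
      using that W_trans by blast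
    show "(a, c) \<in> L"
      if "(a, b) \<in> W - Id_on X \<and> (b, c) \<in> L \<or> (a, b) \<in> L \<and> (b, c) \<in> W - Id_on X"
      using that L_left L_right by blast
  qed
  moreover have "irrefl (W - Id_on X)"
    using W_sub by (auto simp: irrefl_def)
  moreover have "bowtie (X, P \<union> C, P \<union> Q) = (X, D, W - Id_on X)"
    unfolding bowtie.simps Let_def sqsub_cl_def W_def[symmetric] R_def[symmetric] absorb L_eq
    by (simp add: D_def)
  moreover have "W - Id_on X \<subseteq> X \<times> X"
    using W_sub by blast
  ultimately show ?thesis
    using \<open>sym D\<close> \<open>irrefl D\<close> \<open>D \<subseteq> X \<times> X\<close> by (simp only: gso_structure.simps DL simp_thms)
qed

text \<open>Both occurrences come from one \<open>enum_step s i\<close>, so their labels are members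
  of the single step \<open>s ! i\<close>.\<close>

lemma same_pos_labels_sim:
  assumes "s \<in> step_sequences E sim"
    and "\<alpha> \<in> occs s" "\<beta> \<in> occs s" "pos s \<alpha> = pos s \<beta>" "label \<alpha> \<noteq> label \<beta>"
  shows "(label \<alpha>, label \<beta>) \<in> sim"
proof -
  obtain i where i: "i < length s" "\<alpha> \<in> enum_step s i" "\<beta> \<in> enum_step s i"
    using pos_iff[THEN iffD1, OF assms(2) assms(4)] pos_iff[THEN iffD1, OF assms(3) refl]
    by blast
  then have "label \<alpha> \<in> s ! i" "label \<beta> \<in> s ! i"
    by (auto simp: enum_step_def)
  moreover have "s ! i \<in> steps E sim"
    using assms(1) i(1) by (auto simp: step_sequences_def in_lists_conv_set)
  ultimately show ?thesis
    using assms(5) by (auto simp: steps_def)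
qed

theorem theorem11p1:
  fixes E :: "'e set" and sim ser inl :: "'e rel" and s :: "'e set list"
  assumes "g_comtrace_alphabet E sim ser inl"
    and "s \<in> step_sequences E sim"
  shows "gso_structure (step_seq_struct ser inl s)"
proof -
  interpret g_comtrace_alphabet E sim ser inl by fact
  have prec: "prec_rel ser inl s \<subseteq> before s"
    by (auto simp: prec_rel_def Let_def)
  have sqsub: "sqsub_rel ser inl s \<subseteq> not_after s"
    by (auto simp: sqsub_rel_def)
  show ?thesis
    unfolding step_seq_struct_def
  proof (rule gso_structure_bowtie[where f = "pos s"])
    show "prec_rel ser inl s \<subseteq> occs s \<times> occs s"
      using prec by (auto simp: before_def)
    show "sqsub_rel ser inl s \<subseteq> occs s \<times> occs s"
      using sqsub by (auto simp: not_after_def)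
    show "comm_rel inl s \<subseteq> occs s \<times> occs s"
      by (auto simp: comm_rel_def)
    show "sym (comm_rel inl s)"
      using sym_inl by (auto simp: comm_rel_def sym_def)
  next
    fix \<alpha> \<beta> assume "(\<alpha>, \<beta>) \<in> prec_rel ser inl s \<union> sqsub_rel ser inl s"
    then show "pos s \<alpha> \<le> pos s \<beta>"
      using prec sqsub by (fastforce simp: before_def not_after_def)
  next
    fix \<alpha> \<beta> assume "(\<alpha>, \<beta>) \<in> prec_rel ser inl s \<union> comm_rel inl s"
    then show "pos s \<alpha> \<noteq> pos s \<beta>"
    proof
      assume "(\<alpha>, \<beta>) \<in> prec_rel ser inl s"
      then show ?thesis using prec by (auto simp: before_def)
    next
      assume "(\<alpha>, \<beta>) \<in> comm_rel inl s"
      then have occ: "\<alpha> \<in> occs s" "\<beta> \<in> occs s" and inl: "(label \<alpha>, label \<beta>) \<in> inl"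
        by (auto simp: comm_rel_def)
      \<comment> \<open>Distinct labels at equal positions would be related by \<open>sim\<close> as
        well as by \<open>inl\<close>, contradicting disjointness.\<close>
      have "label \<alpha> \<noteq> label \<beta>"
        using inl irrefl_inl by (auto simp: irrefl_def)
      with occ inl show ?thesis
        using same_pos_labels_sim[OF assms(2)] sim_inl_disjoint by blast
    qed
  qed
qed

end
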